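(* Let $Stab(\ell)\subset sl(3,\mathbb O)$ be the set of elements $X\in sl(3,\mathbb O)$, acting linearly on $M_3(\mathbb O)$, such that for every $\chi\in M_3(\mathbb O)$ the coefficient of $\ell$ in the $(2,1)$ entry of $X\chi$ is zero. Then $Stab(\ell)$ is a $52$-dimensional Lie subalgebra of $sl(3,\mathbb O)$ which is neither simple nor semi-simple: it consists of a subalgebra isomorphic to $so(8,1,\mathbb R)$ together with an abelian ideal $b$ of $Stab(\ell)$ of dimension $16$ (that is, $Stab(\ell)=so(8,1,\mathbb R)\oplus b$ as a vector space).
   Context: $\mathbb O$ is the algebra of octonions with real basis $1,i,j,k,k\ell,j\ell,i\ell,\ell$ (the standard imaginary units, $k=ij$, and $i\ell,j\ell,k\ell$ the products of $i,j,k$ with $\ell$). $M_3(\mathbb O)$ is the 27-dimensional real vector space of $3\times3$ octonionic hermitian matrices $$\chi=\begin{pmatrix} p&\bar a&c\\ a&m&\bar b\\ \bar c&b&n\end{pmatrix},\qquad p,m,n\in\mathbb R,\ a,b,c\in\mathbb O,$$ with determinant $\det\chi=pmn-(p|b|^2+m|c|^2+n|a|^2)+2\,\mathrm{Re}(\bar a\bar b\bar c)$. $SL(3,\mathbb O)$ is the group of real-linear maps $M_3(\mathbb O)\to M_3(\mathbb O)$ preserving $\det$ (a 78-dimensional real form of $E_6$), and $sl(3,\mathbb O)$ is its Lie algebra, regarded as a Lie algebra of linear maps of $M_3(\mathbb O)$. *)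

theory Defs
  imports "HOL-Analysis.Analysis"
begin

section \<open>Octonions\<close>

text \<open>Cayley-Dickson doubling. The quaternion \<open>(z, w)\<close> stands for \<open>z + w j\<close> with
  \<open>z, w\<close> complex, and the octonion \<open>(q, r)\<close> for \<open>q + r l\<close> with \<open>q, r\<close> quaternions. Addition,
  scalars, inner product and norm are those of the product type, i.e. of Euclidean 8-space.\<close>

type_synonym quat = "complex \<times> complex"
type_synonym octo = "quat \<times> quat"

fun qcnj :: "quat \<Rightarrow> quat" where
  "qcnj (z, w) = (cnj z, - w)"

fun qmul :: "quat \<Rightarrow> quat \<Rightarrow> quat" where
  "qmul (a, b) (c, d) = (a * c - cnj d * b, d * a + b * cnj c)"

fun ocnj :: "octo \<Rightarrow> octo" where
  "ocnj (q, r) = (qcnj q, - r)"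

fun omul :: "octo \<Rightarrow> octo \<Rightarrow> octo" (infixl "\<odot>" 70) where
  "(a, b) \<odot> (c, d) = (qmul a c - qmul (qcnj d) b, qmul d a + qmul b (qcnj c))"

definition oreal :: "real \<Rightarrow> octo" where
  "oreal x = ((complex_of_real x, 0), 0)"

definition ore :: "octo \<Rightarrow> real" where
  "ore x = Re (fst (fst x))"

definition oi :: octo where "oi = ((\<i>, 0), 0)"
definition oj :: octo where "oj = ((0, 1), 0)"
definition ol :: octo where "ol = (0, (1, 0))"
definition ok :: octo where "ok = oi \<odot> oj"
definition okl :: octo where "okl = ok \<odot> ol"
definition ojl :: octo where "ojl = oj \<odot> ol"
definition oil :: octo where "oil = oi \<odot> ol"

text \<open>The standard units are the orthonormal basis of \<^typ>\<open>octo\<close>, so the coefficient of a unit is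
  the inner product with it.\<close>

lemma Basis_octo: "(Basis :: octo set) = {oreal 1, oi, oj, ok, okl, ojl, oil, ol}"
  unfolding Basis_prod_def Basis_complex_def oreal_def oi_def oj_def ok_def okl_def ojl_def
    oil_def ol_def
  by (auto simp: zero_prod_def)

definition l_coeff :: "octo \<Rightarrow> real" where
  "l_coeff x = x \<bullet> ol"

lemma omul_oreal_left: "oreal r \<odot> x = r *\<^sub>R x"
  by (cases x) (auto simp: oreal_def zero_prod_def scaleR_conv_of_real)

lemma omul_ocnj: "x \<odot> ocnj x = oreal ((norm x)\<^sup>2)"
proof -
  obtain a b c d where x: "x = ((a, b), (c, d))" by (metis surj_pair)
  show ?thesis
    by (simp add: x oreal_def zero_prod_def norm_prod_def complex_eq_iff power2_eq_square
        cmod_def algebra_simps)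
qed

section \<open>Hermitian octonionic 3 by 3 matrices\<close>

text \<open>\<open>(p, m, n, a, b, c)\<close> are the free entries of a hermitian matrix; \<open>hmat\<close> displays the
  matrix itself.\<close>

type_synonym herm = "real \<times> real \<times> real \<times> octo \<times> octo \<times> octo"

fun hmat :: "herm \<Rightarrow> octo^3^3" where
  "hmat (p, m, n, a, b, c) =
     vector [vector [oreal p, ocnj a, c],
             vector [a, oreal m, ocnj b],
             vector [ocnj c, b, oreal n]]"

text \<open>The real part of a triple product does not depend on the bracketing.\<close>

fun hdet :: "herm \<Rightarrow> real" where
  "hdet (p, m, n, a, b, c) =
     p * m * n - (p * (norm b)\<^sup>2 + m * (norm c)\<^sup>2 + n * (norm a)\<^sup>2)
     + 2 * ore ((ocnj a \<odot> ocnj b) \<odot> ocnj c)"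

lemma ocnj_ocnj [simp]: "ocnj (ocnj x) = x"
  by (cases x; cases "fst x"; cases "snd x") auto

lemma ocnj_oreal [simp]: "ocnj (oreal r) = oreal r"
  by (simp add: oreal_def zero_prod_def)

lemma ocnj_fixed: "ocnj x = x \<longleftrightarrow> x = oreal (ore x)"
  by (cases x; cases "fst x"; cases "snd x")
     (auto simp: oreal_def ore_def zero_prod_def complex_eq_iff)

lemma linear_hmat: "linear hmat"
  by (rule linearI)
     (auto simp: vec_eq_iff forall_3 oreal_def zero_prod_def scaleR_conv_of_real split: prod.splits)

lemma bij_betw_hmat: "bij_betw hmat UNIV {A. \<forall>i j. A $ i $ j = ocnj (A $ j $ i)}"
proof (rule bij_betwI')
  show "(hmat x = hmat y) = (x = y)" for x y
    by (cases x; cases y) (auto simp: vec_eq_iff forall_3 oreal_def)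
  show "hmat x \<in> {A. \<forall>i j. A $ i $ j = ocnj (A $ j $ i)}" for x
  proof -
    obtain p m n a b c where "x = (p, m, n, a, b, c)"
      by (metis surj_pair)
    then show ?thesis
      by (simp add: forall_3)
  qed
next
  fix A :: "octo^3^3"
  assume "A \<in> {A. \<forall>i j. A $ i $ j = ocnj (A $ j $ i)}"
  then have h: "A $ i $ j = ocnj (A $ j $ i)" for i j
    by blast
  have d: "A $ i $ i = oreal (ore (A $ i $ i))" for i
    by (rule ocnj_fixed[THEN iffD1, OF h[symmetric]])
  have "A = hmat (ore (A$1$1), ore (A$2$2), ore (A$3$3), A$2$1, A$3$2, A$1$3)"
    by (simp add: vec_eq_iff forall_3 d[symmetric] h[symmetric])
  then show "\<exists>x\<in>UNIV. A = hmat x" by blast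
qed

section \<open>The group of determinant preserving maps and its Lie algebra\<close>

text \<open>As \<^typ>\<open>herm\<close> is finite-dimensional, \<open>herm \<Rightarrow>\<^sub>L herm\<close> consists of all real-linear maps.\<close>

definition SL3O :: "(herm \<Rightarrow>\<^sub>L herm) set" where
  "SL3O = {f. \<forall>x. hdet (blinfun_apply f x) = hdet x}"

definition exp_blinfun :: "('a::euclidean_space \<Rightarrow>\<^sub>L 'a) \<Rightarrow> 'a \<Rightarrow>\<^sub>L 'a" where
  "exp_blinfun X = (\<Sum>n. (1 / fact n) *\<^sub>R ((\<lambda>Y. X o\<^sub>L Y) ^^ n) id_blinfun)"

lemma summable_exp_blinfun:
  fixes X :: "'a::euclidean_space \<Rightarrow>\<^sub>L 'a"
  shows "summable (\<lambda>n. (1 / fact n) *\<^sub>R ((\<lambda>Y. X o\<^sub>L Y) ^^ n) id_blinfun)"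
proof (rule summable_comparison_test')
  show "summable (\<lambda>n. inverse (fact n) * norm X ^ n)"
    by (rule summable_exp)
  have "norm (((\<lambda>Y. X o\<^sub>L Y) ^^ n) id_blinfun) \<le> norm X ^ n" for n
  proof (induction n)
    case 0
    show ?case by (simp add: norm_blinfun_id_le)
  next
    case (Suc n)
    then show ?case
      using norm_blinfun_compose[of X "((\<lambda>Y. X o\<^sub>L Y) ^^ n) id_blinfun"]
        mult_left_mono[OF Suc norm_ge_zero[of X]]
      by simp
  qed
  then show "norm ((1 / fact n) *\<^sub>R ((\<lambda>Y. X o\<^sub>L Y) ^^ n) id_blinfun)
      \<le> inverse (fact n) * norm X ^ n" if "n \<ge> 0" for n
    by (simp add: divide_inverse mult_left_mono)
qed

text \<open>The Lie algebra of a closed group \<open>G\<close> of linear maps.\<close>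

definition lie_algebra_of :: "('a::euclidean_space \<Rightarrow>\<^sub>L 'a) set \<Rightarrow> ('a \<Rightarrow>\<^sub>L 'a) set" where
  "lie_algebra_of G = {X. \<forall>t::real. exp_blinfun (t *\<^sub>R X) \<in> G}"

definition sl3O :: "(herm \<Rightarrow>\<^sub>L herm) set" where
  "sl3O = lie_algebra_of SL3O"

definition commutator :: "('a::real_normed_vector \<Rightarrow>\<^sub>L 'a) \<Rightarrow> ('a \<Rightarrow>\<^sub>L 'a) \<Rightarrow> 'a \<Rightarrow>\<^sub>L 'a" where
  "commutator X Y = (X o\<^sub>L Y) - (Y o\<^sub>L X)"

definition Stab_l :: "(herm \<Rightarrow>\<^sub>L herm) set" where
  "Stab_l = {X \<in> sl3O. \<forall>x. l_coeff (hmat (X x) $ 2 $ 1) = 0}"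

section \<open>The Lie algebra so(8,1)\<close>

definition minkowski_form :: "real^9^9" where
  "minkowski_form = (\<chi> i j. if i \<noteq> j then 0 else if i = 9 then - 1 else 1)"

definition so81 :: "(real^9^9) set" where
  "so81 = {A. transpose A ** minkowski_form + minkowski_form ** A = 0}"

definition mat_commutator :: "real^'n^'n \<Rightarrow> real^'n^'n \<Rightarrow> real^'n^'n" where
  "mat_commutator A B = A ** B - B ** A"

section \<open>Lie-algebraic notions relative to a bracket\<close>

definition lie_subalgebra ::
  "('a::real_vector \<Rightarrow> 'a \<Rightarrow> 'a) \<Rightarrow> 'a set \<Rightarrow> 'a set \<Rightarrow> bool" where
  "lie_subalgebra br H L \<longleftrightarrow> H \<subseteq> L \<and> subspace H \<and> (\<forall>x\<in>H. \<forall>y\<in>H. br x y \<in> H)"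

definition lie_ideal ::
  "('a::real_vector \<Rightarrow> 'a \<Rightarrow> 'a) \<Rightarrow> 'a set \<Rightarrow> 'a set \<Rightarrow> bool" where
  "lie_ideal br I L \<longleftrightarrow> I \<subseteq> L \<and> subspace I \<and> (\<forall>x\<in>L. \<forall>y\<in>I. br x y \<in> I)"

definition lie_abelian :: "('a::real_vector \<Rightarrow> 'a \<Rightarrow> 'a) \<Rightarrow> 'a set \<Rightarrow> bool" where
  "lie_abelian br L \<longleftrightarrow> (\<forall>x\<in>L. \<forall>y\<in>L. br x y = 0)"

definition lie_simple :: "('a::real_vector \<Rightarrow> 'a \<Rightarrow> 'a) \<Rightarrow> 'a set \<Rightarrow> bool" where
  "lie_simple br L \<longleftrightarrow> \<not> lie_abelian br L \<and> (\<forall>I. lie_ideal br I L \<longrightarrow> I = {0} \<or> I = L)"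

fun derived_series :: "('a::real_vector \<Rightarrow> 'a \<Rightarrow> 'a) \<Rightarrow> 'a set \<Rightarrow> nat \<Rightarrow> 'a set" where
  "derived_series br L 0 = L"
| "derived_series br L (Suc n) =
     span {br x y |x y. x \<in> derived_series br L n \<and> y \<in> derived_series br L n}"

definition lie_solvable :: "('a::real_vector \<Rightarrow> 'a \<Rightarrow> 'a) \<Rightarrow> 'a set \<Rightarrow> bool" where
  "lie_solvable br L \<longleftrightarrow> (\<exists>n. derived_series br L n = {0})"

definition lie_semisimple :: "('a::real_vector \<Rightarrow> 'a \<Rightarrow> 'a) \<Rightarrow> 'a set \<Rightarrow> bool" where
  "lie_semisimple br L \<longleftrightarrow> (\<forall>I. lie_ideal br I L \<and> lie_solvable br I \<longrightarrow> I = {0})"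

text \<open>Asking for a map that is linear on the whole ambient space is no restriction: a linear map
  on a subspace extends.\<close>

definition lie_isomorphic ::
  "('a::real_vector \<Rightarrow> 'a \<Rightarrow> 'a) \<Rightarrow> 'a set \<Rightarrow> ('b::real_vector \<Rightarrow> 'b \<Rightarrow> 'b) \<Rightarrow> 'b set \<Rightarrow> bool" where
  "lie_isomorphic br1 L br2 M \<longleftrightarrow>
     (\<exists>f. linear f \<and> bij_betw f L M \<and> (\<forall>x\<in>L. \<forall>y\<in>L. f (br1 x y) = br2 (f x) (f y)))"

end

theory Submission
  imports Defs
begin

text \<open>A hermitian matrix consists of a vector \<open>v = (p, m, a)\<close> in a 10-dimensional Lorentz space with
  form \<open>\<langle>v, v\<rangle> = p m - |a|\<^sup>2\<close>, a spinor \<open>s = (b, c)\<close> in a 16-dimensional Euclidean space, and a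
  number \<open>n\<close>. In these terms the determinant is \<open>n \<langle>v, v\<rangle> - s \<bullet> clif v s\<close>, where \<open>clif\<close> satisfies
  the Clifford relation \<open>clif_square\<close>; these two facts hold almost all of what is needed about
  octonions. The coefficient of \<open>l\<close> in the (2,1) entry is, up to sign, the product of \<open>v\<close> with a
  vector \<open>l\<close> of length \<open>-1\<close>.

  By \<open>lie_algebra_of_invariance\<close> and polarisation, \<open>X\<close> belongs to sl(3,O) if and only if it
  annihilates the trilinear form of the determinant (\<open>sl3O_iff\<close>, \<open>sl3O_tri\<close>). Together with
  orthogonality of the image of \<open>X\<close> to \<open>l\<close>, this forces (\<open>Stab_l_blocks\<close>)
  \<open>X (v, s, n) = (A v, F s + clif (bar v) d, 2 (d \<bullet> s))\<close>
  with a spinor \<open>d\<close>, a map \<open>A\<close> that is skew for the Lorentz form and has image orthogonal to \<open>l\<close>,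
  and a map \<open>F\<close> that is compatible with \<open>A\<close>. The spinor \<open>d\<close> is arbitrary. The map \<open>A\<close> annihilates
  \<open>l\<close>, so it is an arbitrary element of so(8,1), acting on the complement of \<open>l\<close>: a compatible \<open>F\<close>
  exists by the spinor representation (\<open>spin_rot_compatible\<close>), and it is unique because only reals
  lie in the nucleus of the octonions (\<open>clifford_commutant\<close>). Hence \<open>X \<mapsto> (A, d)\<close> is a linear
  bijection of the stabiliser onto the product of so(8,1) and the spinor space, of dimension
  36 + 16. The map \<open>X \<mapsto> A\<close> is a homomorphism of Lie algebras; its kernel is the ideal, which is
  abelian because \<open>clif v\<close> is symmetric, and the elements with \<open>d = 0\<close> form a complementary
  subalgebra. A nonzero proper abelian ideal excludes simplicity and semisimplicity.\<close>

section \<open>Octonion identities\<close>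

lemma omul_add_left: "(x + y) \<odot> z = x \<odot> z + y \<odot> z"
  and omul_add_right: "z \<odot> (x + y) = z \<odot> x + z \<odot> y"
  and omul_scaleR_left: "(r *\<^sub>R x) \<odot> z = r *\<^sub>R (x \<odot> z)"
  and omul_scaleR_right: "z \<odot> (r *\<^sub>R x) = r *\<^sub>R (z \<odot> x)"
  by (cases x; cases "fst x"; cases "snd x"; cases y; cases "fst y"; cases "snd y";
      cases z; cases "fst z"; cases "snd z";
      simp add: scaleR_conv_of_real algebra_simps)+

lemma ocnj_add: "ocnj (x + y) = ocnj x + ocnj y"
  and ocnj_scaleR: "ocnj (r *\<^sub>R x) = r *\<^sub>R ocnj x"
  and ocnj_omul: "ocnj (x \<odot> y) = ocnj y \<odot> ocnj x"
  and inner_ocnj: "ocnj x \<bullet> ocnj y = x \<bullet> y"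
  by (cases x; cases "fst x"; cases "snd x"; cases y; cases "fst y"; cases "snd y";
      simp add: scaleR_conv_of_real algebra_simps inner_complex_def)+

lemma inner_omul_left: "(x \<odot> y) \<bullet> z = y \<bullet> (ocnj x \<odot> z)"
  by (cases x; cases "fst x"; cases "snd x"; cases y; cases "fst y"; cases "snd y";
      cases z; cases "fst z"; cases "snd z";
      simp add: inner_complex_def algebra_simps)

lemma ore_omul: "ore (x \<odot> y) = x \<bullet> ocnj y"
  by (cases x; cases "fst x"; cases "snd x"; cases y; cases "fst y"; cases "snd y";
      simp add: ore_def inner_complex_def algebra_simps)

text \<open>A case of alternativity: two octonions generate an associative algebra. The Clifford relation
  for vectors and spinors rests on it.\<close>

lemma omul_alternative: "ocnj x \<odot> (x \<odot> y) = (x \<bullet> x) *\<^sub>R y"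
  by (cases x; cases "fst x"; cases "snd x"; cases y; cases "fst y"; cases "snd y";
      simp add: inner_complex_def complex_eq_iff algebra_simps power2_eq_square)

lemma omul_zero [simp]: "x \<odot> 0 = 0" "0 \<odot> x = 0" "ocnj 0 = 0"
  using omul_scaleR_left[of 0 0 x] omul_scaleR_right[of x 0 0] ocnj_scaleR[of 0 0] by auto

lemma omul_one: "oreal 1 \<odot> x = x" "x \<odot> oreal 1 = x"
proof -
  show left: "oreal 1 \<odot> x = x" for x
    by (simp add: omul_oreal_left)
  have "ocnj (oreal 1 \<odot> ocnj x) = x \<odot> oreal 1"
    unfolding ocnj_omul by simp
  then show "x \<odot> oreal 1 = x"
    unfolding left by simp
qed

section \<open>The Lie algebra of a group of linear maps preserving a function\<close>

text \<open>The matrix entries of \<open>exp (t X)\<close> are convergent real power series in \<open>t\<close>, so that they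
  can be differentiated term by term.\<close>

lemma exp_blinfun_inner_powser:
  fixes X :: "'a::euclidean_space \<Rightarrow>\<^sub>L 'a"
  defines "P \<equiv> \<lambda>n. ((\<lambda>Y. X o\<^sub>L Y) ^^ n) id_blinfun"
  shows "(\<lambda>n. (P n x \<bullet> b / fact n) * t ^ n) sums (exp_blinfun (t *\<^sub>R X) x \<bullet> b)"
proof -
  have pw: "((\<lambda>Y. (t *\<^sub>R X) o\<^sub>L Y) ^^ n) id_blinfun = t ^ n *\<^sub>R P n" for n
    unfolding P_def
    by (induction n) (auto simp: blinfun.scaleR_left blinfun.scaleR_right intro!: blinfun_eqI)
  have "bounded_linear (\<lambda>E :: 'a \<Rightarrow>\<^sub>L 'a. E x \<bullet> b)"
    by (intro bounded_linear_intros)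
  then have "(\<lambda>n. ((1 / fact n) *\<^sub>R ((\<lambda>Y. (t *\<^sub>R X) o\<^sub>L Y) ^^ n) id_blinfun) x \<bullet> b) sums
      (exp_blinfun (t *\<^sub>R X) x \<bullet> b)"
    using summable_sums[OF summable_exp_blinfun[of "t *\<^sub>R X"]]
    unfolding exp_blinfun_def by (rule bounded_linear.sums)
  then show ?thesis
    unfolding pw by (simp add: blinfun.scaleR_left mult.commute)
qed

lemma exp_blinfun_has_vector_derivative:
  fixes X :: "'a::euclidean_space \<Rightarrow>\<^sub>L 'a"
  shows "((\<lambda>t. exp_blinfun (t *\<^sub>R X) x) has_vector_derivative X (exp_blinfun (t *\<^sub>R X) x)) (at t)"
proof -
  define P where "P = (\<lambda>n. ((\<lambda>Y. X o\<^sub>L Y) ^^ n) id_blinfun)"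
  have ps: "(\<lambda>n. (P n x \<bullet> b / fact n) * t ^ n) sums (exp_blinfun (t *\<^sub>R X) x \<bullet> b)" for x b t
    unfolding P_def by (rule exp_blinfun_inner_powser)
  have "((\<lambda>t. exp_blinfun (t *\<^sub>R X) x \<bullet> b) has_field_derivative X (exp_blinfun (t *\<^sub>R X) x) \<bullet> b) (at t)"
    for b
  proof -
    define c where "c = (\<lambda>n. P n x \<bullet> b / fact n)"
    have "((\<lambda>t. \<Sum>n. c n * t ^ n) has_field_derivative (\<Sum>n. diffs c n * t ^ n)) (at t)"
      using ps unfolding c_def
      by (intro termdiffs_strong_converges_everywhere) (auto simp: sums_iff)
    moreover have "(\<Sum>n. c n * t ^ n) = exp_blinfun (t *\<^sub>R X) x \<bullet> b" for t
      using ps unfolding c_def by (simp add: sums_iff)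
    moreover have "(\<Sum>n. diffs c n * t ^ n) = X (exp_blinfun (t *\<^sub>R X) x) \<bullet> b"
    proof -
      define b' where "b' = adjoint X b"
      have adj: "X y \<bullet> b = y \<bullet> b'" for y
        unfolding b'_def using adjoint_works[OF bounded_linear.linear[OF blinfun.bounded_linear_right]] by metis
      have "diffs c n = P n x \<bullet> b' / fact n" for n
      proof -
        have "diffs c n = of_nat (Suc n) * (P n x \<bullet> b' / (of_nat (Suc n) * fact n))"
          unfolding diffs_def c_def P_def by (simp add: adj del: of_nat_Suc)
        then show ?thesis by (simp del: of_nat_Suc)
      qed
      then show ?thesis
        using ps[of x b' t] unfolding adj by (simp add: sums_iff)
    qed
    ultimately show ?thesis by simp
  qed
  then have "((\<lambda>t. exp_blinfun (t *\<^sub>R X) x \<bullet> b) has_derivative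
      (\<lambda>h. (h *\<^sub>R X (exp_blinfun (t *\<^sub>R X) x)) \<bullet> b)) (at t)" for b
    by (simp add: has_field_derivative_def mult_commute_abs)
  then show ?thesis
    unfolding has_vector_derivative_def by (subst has_derivative_componentwise_within) blast
qed

text \<open>Along the curve \<open>t \<mapsto> exp (t X) x\<close> the function \<open>\<phi>\<close> has derivative \<open>\<phi>'\<close> in the direction
  of \<open>X\<close> applied to the current point. Invariance makes this vanish at \<open>t = 0\<close>; conversely, if it
  vanishes everywhere then \<open>\<phi>\<close> is constant on the curve.\<close>

lemma lie_algebra_of_invariance:
  fixes \<phi> :: "'a::euclidean_space \<Rightarrow> real"
  assumes der: "\<And>x. (\<phi> has_derivative \<phi>' x) (at x)"
  shows "lie_algebra_of {f. \<forall>x. \<phi> (blinfun_apply f x) = \<phi> x} = {X. \<forall>x. \<phi>' x (blinfun_apply X x) = 0}"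
proof -
  have curve: "((\<lambda>t. \<phi> (exp_blinfun (t *\<^sub>R X) x)) has_real_derivative
      \<phi>' (exp_blinfun (t *\<^sub>R X) x) (X (exp_blinfun (t *\<^sub>R X) x))) (at t)" for X x t
    using vector_derivative_diff_chain_within
      [OF exp_blinfun_has_vector_derivative has_derivative_at_withinI[OF der]]
    by (simp add: o_def has_real_derivative_iff_has_vector_derivative)
  have e0: "exp_blinfun (0 *\<^sub>R X) x = x" for X :: "'a \<Rightarrow>\<^sub>L 'a" and x
  proof (rule euclidean_eqI)
    fix b :: 'a
    let ?c = "\<lambda>n. ((\<lambda>Y. X o\<^sub>L Y) ^^ n) id_blinfun x \<bullet> b / fact n"
    have "(\<lambda>n. ?c n * 0 ^ n) sums (x \<bullet> b)"
      using powser_sums_zero[of ?c] by simp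
    then show "exp_blinfun (0 *\<^sub>R X) x \<bullet> b = x \<bullet> b"
      using exp_blinfun_inner_powser[of X x b 0] sums_unique2 by blast
  qed
  show ?thesis
  proof (intro equalityI subsetI CollectI allI)
    fix X x assume "X \<in> lie_algebra_of {f. \<forall>x. \<phi> (blinfun_apply f x) = \<phi> x}"
    then have "\<phi> (exp_blinfun (t *\<^sub>R X) x) = \<phi> x" for t
      unfolding lie_algebra_of_def by blast
    then have "((\<lambda>t. \<phi> x) has_real_derivative \<phi>' x (X x)) (at 0)"
      using curve[of X x 0] unfolding e0 by simp
    then show "\<phi>' x (X x) = 0"
      using DERIV_const DERIV_unique by blast
  next
    fix X assume X: "X \<in> {X. \<forall>x. \<phi>' x (blinfun_apply X x) = 0}"
    have "\<phi> (exp_blinfun (t *\<^sub>R X) x) = \<phi> x" for t x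
    proof -
      have "\<phi> (exp_blinfun (t *\<^sub>R X) x) = \<phi> (exp_blinfun (0 *\<^sub>R X) x)"
        using curve[of X x] X by (intro DERIV_isconst_all) simp
      then show ?thesis unfolding e0 .
    qed
    then show "X \<in> lie_algebra_of {f. \<forall>x. \<phi> (blinfun_apply f x) = \<phi> x}"
      unfolding lie_algebra_of_def by blast
  qed
qed

section \<open>Vectors and spinors\<close>

type_synonym mink = "real \<times> real \<times> octo"
type_synonym spin = "octo \<times> octo"

text \<open>The upper left 2 by 2 block is a vector of a 10-dimensional Lorentz space, whose quadratic form
  is the 2 by 2 determinant \<open>p m - |a|\<^sup>2\<close>; the remaining off-diagonal entries form a spinor.\<close>

fun mform :: "mink \<Rightarrow> mink \<Rightarrow> real" where
  "mform (p, m, a) (p', m', a') = (p * m' + p' * m) / 2 - a \<bullet> a'"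

text \<open>The gamma matrices of the half-spin representations: \<open>clif v\<close> and \<open>clif (bar v)\<close> are the
  Clifford action of \<open>v\<close> between the two 16-dimensional half-spin spaces, both realised on
  \<^typ>\<open>spin\<close>. It is read off from the part of the determinant that is quadratic in \<open>(b, c)\<close>.\<close>

fun clif :: "mink \<Rightarrow> spin \<Rightarrow> spin" where
  "clif (p, m, a) (b, c) = (p *\<^sub>R b - ocnj (a \<odot> c), m *\<^sub>R c - ocnj (b \<odot> a))"

fun bar :: "mink \<Rightarrow> mink" where
  "bar (p, m, a) = (m, p, - a)"

fun assemble :: "mink \<Rightarrow> spin \<Rightarrow> real \<Rightarrow> herm" where
  "assemble (p, m, a) (b, c) n = (p, m, n, a, b, c)"

fun vpart :: "herm \<Rightarrow> mink" where "vpart (p, m, n, a, b, c) = (p, m, a)"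
fun spart :: "herm \<Rightarrow> spin" where "spart (p, m, n, a, b, c) = (b, c)"
fun npart :: "herm \<Rightarrow> real" where "npart (p, m, n, a, b, c) = n"

lemma parts_assemble [simp]:
  "vpart (assemble v s n) = v" "spart (assemble v s n) = s" "npart (assemble v s n) = n"
  "assemble (vpart x) (spart x) (npart x) = x"
  by (cases v; cases s; auto; fail)+ (cases x; auto)

lemma herm_cases: obtains v s n where "x = assemble v s n"
  by (metis parts_assemble(4))

lemma parts_linear [simp]:
  "vpart (x + y) = vpart x + vpart y" "spart (x + y) = spart x + spart y"
  "npart (x + y) = npart x + npart y"
  "vpart (r *\<^sub>R x) = r *\<^sub>R vpart x" "spart (r *\<^sub>R x) = r *\<^sub>R spart x"
  "npart (r *\<^sub>R x) = r * npart x"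
  by (cases x; cases y; simp; fail)+

lemma linear_vpart: "linear vpart" and linear_spart: "linear spart" and linear_npart: "linear npart"
  by (auto intro!: linearI)

lemma assemble_add: "assemble v s n + assemble v' s' n' = assemble (v + v') (s + s') (n + n')"
  by (cases v; cases s; cases v'; cases s') auto

lemma assemble_scaleR: "r *\<^sub>R assemble v s n = assemble (r *\<^sub>R v) (r *\<^sub>R s) (r * n)"
  by (cases v; cases s) auto

lemma bilinear_mform: "bilinear mform"
  unfolding bilinear_def
  by (auto intro!: linearI simp: field_simps inner_simps)

lemma bilinear_clif: "bilinear clif"
  unfolding bilinear_def
  by (auto intro!: linearI simp: algebra_simps ocnj_add ocnj_scaleR
      omul_add_left omul_add_right omul_scaleR_left omul_scaleR_right)

lemmas mform_simps = bilinear_ladd[OF bilinear_mform] bilinear_radd[OF bilinear_mform]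
  bilinear_lmul[OF bilinear_mform] bilinear_rmul[OF bilinear_mform]
  bilinear_lsub[OF bilinear_mform] bilinear_rsub[OF bilinear_mform]
  bilinear_lzero[OF bilinear_mform] bilinear_rzero[OF bilinear_mform]
  bilinear_lneg[OF bilinear_mform] bilinear_rneg[OF bilinear_mform]
lemmas clif_simps = bilinear_ladd[OF bilinear_clif] bilinear_radd[OF bilinear_clif]
  bilinear_lmul[OF bilinear_clif] bilinear_rmul[OF bilinear_clif]
  bilinear_lsub[OF bilinear_clif] bilinear_rsub[OF bilinear_clif]
  bilinear_lzero[OF bilinear_clif] bilinear_rzero[OF bilinear_clif]
  bilinear_lneg[OF bilinear_clif] bilinear_rneg[OF bilinear_clif]

lemma mform_sym: "mform v w = mform w v"
  by (cases v; cases w) (auto simp: inner_commute algebra_simps)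

lemma mform_nondeg: "(\<And>w. mform v w = 0) \<Longrightarrow> v = 0"
proof -
  assume *: "\<And>w. mform v w = 0"
  obtain p m a where v: "v = (p, m, a)" by (cases v)
  show "v = 0"
    using *[of "(0, 1, 0)"] *[of "(1, 0, 0)"] *[of "(0, 0, a)"] unfolding v
    by (simp add: zero_prod_def)
qed

lemma bar_linear: "bar (v + w) = bar v + bar w" "bar (r *\<^sub>R v) = r *\<^sub>R bar v"
  by (cases v; cases w; simp; fail)+

lemma clif_sym: "s \<bullet> clif v t = clif v s \<bullet> t"
proof -
  obtain p m a b c b' c' where v: "v = (p, m, a)" "s = (b, c)" "t = (b', c')"
    by (metis surj_pair)
  have 1: "x \<bullet> ocnj (a \<odot> y) = ocnj (x \<odot> a) \<bullet> y" for x y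
    using inner_omul_left[of a y "ocnj x"] inner_ocnj[of x "ocnj (a \<odot> y)"]
    by (simp add: inner_commute ocnj_omul)
  have 2: "y \<bullet> ocnj (x \<odot> a) = ocnj (a \<odot> y) \<bullet> x" for x y
    using 1[of x y] by (simp add: inner_commute)
  show ?thesis by (simp add: v inner_simps 1 2)
qed

text \<open>The Clifford relation. The diagonal terms give \<open>p m\<close> and the mixed terms cancel; what remains
  is \<open>|a|\<^sup>2\<close>, by alternativity.\<close>

lemma clif_square: "clif v (clif (bar v) s) = mform v v *\<^sub>R s"
proof -
  obtain p m a b c where v: "v = (p, m, a)" "s = (b, c)"
    by (metis surj_pair)
  have 1: "ocnj (a \<odot> ocnj (b \<odot> a)) = (a \<bullet> a) *\<^sub>R b" for b
  proof -
    have "a \<odot> (ocnj a \<odot> ocnj b) = (a \<bullet> a) *\<^sub>R ocnj b"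
      using omul_alternative[of "ocnj a" "ocnj b"] by (simp add: inner_ocnj)
    then show ?thesis by (simp add: ocnj_omul ocnj_scaleR)
  qed
  have 2: "ocnj (ocnj (a \<odot> c) \<odot> a) = (a \<bullet> a) *\<^sub>R c" for c
    using omul_alternative[of a c] by (simp add: ocnj_omul)
  have neg: "ocnj (- x) = - ocnj x" "x \<odot> (- y) = - (x \<odot> y)" "(- x) \<odot> y = - (x \<odot> y)" for x y
    using ocnj_scaleR[of "-1" x] omul_scaleR_left[of "-1" x y] omul_scaleR_right[of x "-1" y]
    by simp_all
  show ?thesis
    by (simp add: v 1 2 neg ocnj_add ocnj_scaleR omul_add_right omul_add_left
        omul_scaleR_left omul_scaleR_right algebra_simps)
qed

lemma clif_anticomm:
  "clif u (clif (bar w) s) + clif w (clif (bar u) s) = (2 * mform u w) *\<^sub>R s"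
  using clif_square[of "u + w" s] mform_sym[of u w]
  by (simp add: bar_linear clif_simps clif_square mform_simps scaleR_add_left algebra_simps)

lemma hdet_parts: "hdet x = npart x * mform (vpart x) (vpart x) - spart x \<bullet> clif (vpart x) (spart x)"
proof -
  obtain p m n a b c where x: "x = (p, m, n, a, b, c)" by (metis surj_pair)
  have 1: "ore ((ocnj a \<odot> ocnj b) \<odot> ocnj c) = c \<bullet> ocnj (b \<odot> a)"
    by (simp add: ore_omul ocnj_omul inner_commute)
  have 2: "c \<bullet> ocnj (b \<odot> a) = b \<bullet> ocnj (a \<odot> c)"
    using clif_sym[of "(0,c)" "(0,0,a)" "(b,0)"] by (simp add: inner_commute)
  show ?thesis
    by (simp add: x 1 2 inner_simps power2_norm_eq_inner algebra_simps)
qed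

(* Matrices, vectors and spinors are single points here, not tuples of octonions. *)
declare split_paired_All [simp del] split_paired_Ex [simp del]

section \<open>The polarised determinant\<close>

text \<open>The symmetric trilinear form with \<open>tri x x x = 3 hdet x\<close>.\<close>

definition tri :: "herm \<Rightarrow> herm \<Rightarrow> herm \<Rightarrow> real" where
  "tri x y z =
     npart x * mform (vpart y) (vpart z) + npart y * mform (vpart x) (vpart z)
     + npart z * mform (vpart x) (vpart y)
     - spart y \<bullet> clif (vpart x) (spart z) - spart x \<bullet> clif (vpart y) (spart z)
     - spart x \<bullet> clif (vpart z) (spart y)"

lemma clif_swap: "s \<bullet> clif v t = t \<bullet> clif v s"
  by (metis clif_sym inner_commute)

lemma tri_sym12: "tri x y z = tri y x z" and tri_sym23: "tri x y z = tri x z y"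
proof -
  show "tri x y z = tri y x z"
    by (simp add: tri_def mform_sym clif_swap[of "spart x" "vpart z" "spart y"])
  show "tri x y z = tri x z y"
    by (simp add: tri_def mform_sym clif_swap[of "spart y" "vpart x" "spart z"])
qed

lemma tri_add: "tri (x + x') y z = tri x y z + tri x' y z"
    "tri x (y + y') z = tri x y z + tri x y' z" "tri x y (z + z') = tri x y z + tri x y z'"
  by (simp_all add: tri_def mform_simps clif_simps inner_simps algebra_simps)

lemma tri_scaleR: "tri (r *\<^sub>R x) y z = r * tri x y z"
    "tri x (r *\<^sub>R y) z = r * tri x y z" "tri x y (r *\<^sub>R z) = r * tri x y z"
  by (simp_all add: tri_def mform_simps clif_simps inner_simps algebra_simps)

lemma tri_diff: "tri x y (z - z') = tri x y z - tri x y z'"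
  using tri_add(3)[of x y z "(-1) *\<^sub>R z'"] tri_scaleR(3)[of x y "-1" z'] by simp

lemma hdet_has_derivative: "(hdet has_derivative (\<lambda>y. tri x x y)) (at x)"
proof -
  have v: "(vpart has_derivative vpart) (at x)" and s: "(spart has_derivative spart) (at x)"
    and n: "(npart has_derivative npart) (at x)"
    by (simp_all add: bounded_linear_imp_has_derivative linear_linear linear_vpart linear_spart
        linear_npart linear_conv_bounded_linear[symmetric])
  have bm: "bounded_bilinear mform" and bc: "bounded_bilinear clif"
    by (simp_all add: bilinear_conv_bounded_bilinear[symmetric] bilinear_mform bilinear_clif)
  have "hdet = (\<lambda>x. npart x * mform (vpart x) (vpart x) - spart x \<bullet> clif (vpart x) (spart x))"
    by (rule ext) (rule hdet_parts)
  moreover have "((\<lambda>x. npart x * mform (vpart x) (vpart x) - spart x \<bullet> clif (vpart x) (spart x))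
      has_derivative (\<lambda>y. (npart x * (mform (vpart x) (vpart y) + mform (vpart y) (vpart x))
        + npart y * mform (vpart x) (vpart x))
        - (spart x \<bullet> (clif (vpart x) (spart y) + clif (vpart y) (spart x))
        + spart y \<bullet> clif (vpart x) (spart x)))) (at x)"
    by (intro has_derivative_diff has_derivative_mult has_derivative_inner
        bounded_bilinear.FDERIV[OF bm] bounded_bilinear.FDERIV[OF bc] v s n)
  ultimately show ?thesis
    by (simp add: tri_def[abs_def] mform_sym inner_add_right algebra_simps
        clif_swap[of "spart _" "vpart x" "spart x"])
qed

lemma sl3O_iff: "X \<in> sl3O \<longleftrightarrow> (\<forall>x. tri x x (X x) = 0)"
  unfolding sl3O_def SL3O_def lie_algebra_of_invariance[OF hdet_has_derivative] by simp

text \<open>The left-hand side is a symmetric trilinear form which vanishes on the diagonal, hence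
  vanishes by polarisation.\<close>

lemma sl3O_tri:
  assumes "X \<in> sl3O"
  shows "tri (X x) y z + tri x (X y) z + tri x y (X z) = 0"
proof -
  define g where "g x y z = tri (X x) y z + tri x (X y) z + tri x y (X z)" for x y z
  have add: "g (x + x') y z = g x y z + g x' y z" "g x (y + y') z = g x y z + g x y' z"
      "g x y (z + z') = g x y z + g x y z'" for x x' y y' z z'
    by (simp_all add: g_def blinfun.add_right tri_add)
  have sym: "g x y z = g y x z" "g x y z = g x z y" for x y z
  proof -
    show "g x y z = g y x z"
      unfolding g_def using tri_sym12[of "X x" y z] tri_sym12[of x "X y" z] tri_sym12[of x y "X z"]
      by linarith
    show "g x y z = g x z y"
      unfolding g_def using tri_sym23[of "X x" y z] tri_sym23[of x "X y" z] tri_sym23[of x y "X z"]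
      by linarith
  qed
  have diag: "g x x x = 0" for x
  proof -
    have "tri x x (X x) = 0" using assms unfolding sl3O_iff by blast
    then show ?thesis
      using tri_sym12[of "X x" x x] tri_sym23[of x "X x" x] unfolding g_def by simp
  qed
  have "0 = g (x + y + z) (x + y + z) (x + y + z) - g (x + y) (x + y) (x + y)
      - g (x + z) (x + z) (x + z) - g (y + z) (y + z) (y + z) + g x x x + g y y y + g z z z"
    unfolding diag by simp
  also have "\<dots> = g x y z + g x z y + g y x z + g y z x + g z x y + g z y x"
    by (simp only: add)
  also have "\<dots> = 6 * g x y z"
    using sym(1)[of x y z] sym(2)[of x y z] sym(1)[of x z y] sym(2)[of y x z] sym(2)[of z x y]
    by linarith
  finally show ?thesis unfolding g_def by simp
qed

text \<open>Put \<open>Y x\<close> for the last argument in the identity for \<open>X\<close>, and conversely: both mixed terms are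
  \<open>tri x (X x) (Y x)\<close>.\<close>

lemma sl3O_commutator:
  assumes "X \<in> sl3O" "Y \<in> sl3O"
  shows "commutator X Y \<in> sl3O"
  unfolding sl3O_iff
proof
  fix x
  have "tri x x (X (Y x)) = tri x x (Y (X x))"
    using sl3O_tri[OF assms(1), of x x "Y x"] sl3O_tri[OF assms(2), of x x "X x"]
      tri_sym12[of x "X x" "Y x"] tri_sym12[of x "Y x" "X x"] tri_sym23[of "X x" x "Y x"]
      tri_sym23[of "Y x" x "X x"] tri_sym12[of "X x" "Y x" x]
    by linarith
  then show "tri x x (commutator X Y x) = 0"
    by (simp add: commutator_def blinfun.diff_left tri_diff)
qed

lemma subspace_sl3O: "subspace sl3O"
  by (rule subspaceI)
     (auto simp: sl3O_iff blinfun.add_left blinfun.scaleR_left tri_add tri_scaleR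
        intro: tri_scaleR(3)[of _ _ 0, simplified])

section \<open>The stabiliser\<close>

definition lvec :: mink where "lvec = (0, 0, ol)"

lemma mform_lvec: "mform lvec lvec = -1"
  by (simp add: lvec_def ol_def inner_complex_def)

lemma Stab_l_eq: "Stab_l = {X \<in> sl3O. \<forall>x. mform (vpart (X x)) lvec = 0}"
proof -
  have "l_coeff (hmat y $ 2 $ 1) = - mform (vpart y) lvec" for y
    by (cases y) (auto simp: l_coeff_def lvec_def)
  then show ?thesis unfolding Stab_l_def by simp
qed

lemma Stab_l_lie_subalgebra: "lie_subalgebra commutator Stab_l sl3O"
  unfolding lie_subalgebra_def
proof (intro conjI ballI)
  show "Stab_l \<subseteq> sl3O" unfolding Stab_l_eq by blast
  show "subspace Stab_l"
    using subspace_sl3O unfolding Stab_l_eq subspace_def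
    by (auto simp: blinfun.add_left blinfun.scaleR_left mform_simps linear_0[OF linear_vpart])
  show "commutator X Y \<in> Stab_l" if "X \<in> Stab_l" "Y \<in> Stab_l" for X Y
    using that sl3O_commutator unfolding Stab_l_eq
    by (auto simp: commutator_def blinfun.diff_left linear_diff[OF linear_vpart] mform_simps)
qed

lemma tri_assemble:
  "tri (assemble v s n) (assemble v' s' n') (assemble v'' s'' n'') =
     n * mform v' v'' + n' * mform v v'' + n'' * mform v v'
     - s' \<bullet> clif v s'' - s \<bullet> clif v' s'' - s \<bullet> clif v'' s'"
  by (simp add: tri_def)

definition time_axis :: mink where "time_axis = (1, 1, 0)"

lemma time_axis [simp]: "clif time_axis s = s" "mform time_axis time_axis = 1"
    "bar time_axis = time_axis"
proof -
  show "clif time_axis s = s" by (cases s) (simp add: time_axis_def)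
qed (simp_all add: time_axis_def)

text \<open>Up to sign, \<open>bar\<close> is the reflection along the time axis.\<close>

lemma bar_eq: "bar v = (2 * mform v time_axis) *\<^sub>R time_axis - v"
  by (cases v) (auto simp: time_axis_def field_simps)

text \<open>Elements of the stabiliser are block triangular, with a skew block \<open>A\<close> on vectors, a spinor
  \<open>d\<close> which determines everything below the diagonal, and a block \<open>F\<close> on spinors tied to \<open>A\<close>.

  All of this comes from evaluating the polarised invariance on pure arguments. The pure number
  \<open>E\<close> has rank one, and on \<open>(E, E, w)\<close> the invariance says that \<open>X E\<close> has no vector part. The
  hypothesis on \<open>l\<close> enters twice, through the fact that \<open>l\<close> is not a null vector: on \<open>(E, l, l)\<close>
  it removes the number part of \<open>X E\<close>, and on \<open>(E, l, s)\<close> it removes the spinor part, because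
  \<open>clif lvec\<close> is invertible. The remaining cases are linear equations for the other blocks.\<close>

lemma Stab_l_blocks:
  assumes X: "X \<in> Stab_l"
  defines "A \<equiv> \<lambda>v. vpart (X (assemble v 0 0))"
    and "F \<equiv> \<lambda>s. spart (X (assemble 0 s 0))"
    and "d \<equiv> spart (X (assemble time_axis 0 0))"
  shows "X (assemble v s n) = assemble (A v) (F s + clif (bar v) d) (2 * (d \<bullet> s))"
    and "mform (A v) v = 0"
    and "mform (A v) lvec = 0"
    and "t \<bullet> clif (A v) t + 2 * (t \<bullet> clif v (F t)) = 0"
proof -
  note tri0 = tri_def mform_simps clif_simps
  have inv: "tri (X x) y z + tri x (X y) z + tri x y (X z) = 0" for x y z
    using X sl3O_tri unfolding Stab_l_eq by blast
  have annih: "mform (vpart (X x)) lvec = 0" for x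
    using X unfolding Stab_l_eq by blast
  define E where "E = X (assemble 0 0 1)"
  \<comment> \<open>\<open>X\<close> annihilates the pure number \<open>E\<close>, and nothing maps spinors to vectors.\<close>
  have E_v: "vpart E = 0"
  proof (rule mform_nondeg)
    fix w show "mform (vpart E) w = 0"
      using inv[of "assemble 0 0 1" "assemble 0 0 1" "assemble w 0 0"]
      by (simp add: E_def[symmetric] tri0)
  qed
  have E_n': "npart E * mform v v + 2 * mform (A v) v = 0" for v
    using inv[of "assemble 0 0 1" "assemble v 0 0" "assemble v 0 0"]
      mform_sym[of v "A v"]
    by (simp add: E_def[symmetric] tri0 A_def)
  have E_n: "npart E = 0"
    using E_n'[of lvec] annih[of "assemble lvec 0 0"] by (simp add: mform_lvec A_def)
  have E_s': "mform v (vpart (X (assemble 0 s 0))) = spart E \<bullet> clif v s" for v s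
    using inv[of "assemble 0 0 1" "assemble v 0 0" "assemble 0 s 0"]
    by (simp add: E_def[symmetric] tri0 E_v)
  have E_s: "spart E = 0"
  proof -
    have "spart E \<bullet> clif lvec (clif (bar lvec) (spart E)) = 0"
      using E_s'[of lvec "clif (bar lvec) (spart E)"] annih mform_sym[of lvec] by metis
    then show ?thesis by (simp add: clif_square mform_lvec)
  qed
  have C0: "vpart (X (assemble 0 s 0)) = 0" for s
    using E_s' mform_sym by (intro mform_nondeg) (metis E_s inner_zero_left)
  show Av: "mform (A v) v = 0" for v
    using E_n' E_n by simp
  show "mform (A v) lvec = 0"
    using annih by (simp add: A_def)
  \<comment> \<open>No vector is mapped to a number: a vector of length one forces it first for itself, then for
    all others.\<close>
  define f where "f v = npart (X (assemble v 0 0))" for v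
  have f': "f u * mform v w + f v * mform u w + f w * mform u v = 0" for u v w
    using inv[of "assemble u 0 0" "assemble v 0 0" "assemble w 0 0"]
    by (simp add: tri0 f_def)
  have f0: "f u = 0" for u
    using f'[of u time_axis time_axis] f'[of time_axis time_axis time_axis] by simp
  \<comment> \<open>The maps from vectors to spinors and from spinors to numbers are both read off from the image
    of the time axis, on which \<open>clif\<close> is the identity.\<close>
  define D where "D v = spart (X (assemble v 0 0))" for v
  define g where "g s = npart (X (assemble 0 s 0))" for s
  have Dg: "g s * mform u v = D u \<bullet> clif v s + D v \<bullet> clif u s" for u v s
    using inv[of "assemble u 0 0" "assemble v 0 0" "assemble 0 s 0"]
    by (simp add: tri0 D_def g_def C0)
  have d: "D time_axis = d" by (simp add: D_def d_def)
  have g: "g s = 2 * (d \<bullet> s)" for s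
    using Dg[of s time_axis time_axis] by (simp add: d)
  have D: "D v = clif (bar v) d" for v
  proof (rule vector_eq_rdot[THEN iffD1], rule allI)
    fix s
    have "D v \<bullet> s = g s * mform v time_axis - d \<bullet> clif v s"
      using Dg[of s v time_axis] by (simp add: d)
    also have "\<dots> = clif (bar v) d \<bullet> s"
      unfolding bar_eq by (simp add: g clif_sym clif_simps inner_simps)
    finally show "D v \<bullet> s = clif (bar v) d \<bullet> s" .
  qed
  show "t \<bullet> clif (A v) t + 2 * (t \<bullet> clif v (F t)) = 0"
    using inv[of "assemble v 0 0" "assemble 0 t 0" "assemble 0 t 0"]
      clif_sym[of "F t" v t] inner_commute[of "F t" "clif v t"] clif_sym[of t v "F t"]
    by (simp add: tri0 A_def F_def)
  have "X (assemble v s n) = X (assemble v 0 0) + X (assemble 0 s 0) + n *\<^sub>R E"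
    unfolding E_def by (simp flip: blinfun.add_right blinfun.scaleR_right
        add: assemble_add assemble_scaleR)
  also have "\<dots> = assemble (A v) (F s + clif (bar v) d) (2 * (d \<bullet> s))"
  proof -
    have "X (assemble v 0 0) = assemble (A v) (D v) (f v)"
      by (simp add: A_def D_def f_def)
    moreover have "X (assemble 0 s 0) = assemble 0 (F s) (g s)"
      by (metis C0 F_def g_def parts_assemble(4))
    moreover have "E = assemble 0 0 0"
      by (metis E_n E_s E_v parts_assemble(4))
    ultimately show ?thesis
      by (simp add: assemble_add assemble_scaleR f0 g D add.commute)
  qed
  finally show "X (assemble v s n) = assemble (A v) (F s + clif (bar v) d) (2 * (d \<bullet> s))" .
qed

section \<open>Constructing elements of the stabiliser\<close>

definition block :: "(mink \<Rightarrow> mink) \<Rightarrow> (spin \<Rightarrow> spin) \<Rightarrow> spin \<Rightarrow> herm \<Rightarrow>\<^sub>L herm" where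
  "block A F d = Blinfun (\<lambda>x. assemble (A (vpart x)) (F (spart x) + clif (bar (vpart x)) d)
     (2 * (d \<bullet> spart x)))"

lemma block_apply:
  assumes "linear A" "linear F"
  shows "block A F d x =
    assemble (A (vpart x)) (F (spart x) + clif (bar (vpart x)) d) (2 * (d \<bullet> spart x))"
proof -
  have "linear (\<lambda>x. assemble (A (vpart x)) (F (spart x) + clif (bar (vpart x)) d)
      (2 * (d \<bullet> spart x)))"
    using linear_add[OF assms(1)] linear_add[OF assms(2)]
      linear_scale[OF assms(1)] linear_scale[OF assms(2)]
    by (intro linearI)
       (simp_all add: assemble_add assemble_scaleR bar_linear clif_simps inner_add_right algebra_simps)
  then show ?thesis
    unfolding block_def by (simp add: bounded_linear_Blinfun_apply linear_conv_bounded_linear)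
qed

text \<open>The spinor \<open>d\<close> is unconstrained: its two contributions to the derivative of the determinant
  cancel by the Clifford relation.\<close>

lemma block_in_Stab_l:
  assumes lin: "linear A" "linear F"
    and A: "\<And>v. mform (A v) v = 0" "\<And>v. mform (A v) lvec = 0"
    and F: "\<And>v t. t \<bullet> clif (A v) t + 2 * (t \<bullet> clif v (F t)) = 0"
  shows "block A F d \<in> Stab_l"
proof -
  have "tri x x (block A F d x) = 0" for x
  proof -
    obtain v s n where x: "x = assemble v s n" by (rule herm_cases)
    have "s \<bullet> clif v (clif (bar v) d) = mform v v * (d \<bullet> s)"
      by (simp add: clif_square inner_commute)
    then show ?thesis
      using F[of s v] A(1)[of v]
      by (simp add: x block_apply[OF lin] tri_assemble mform_sym[of v "A v"] clif_simps
          inner_add_right algebra_simps)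
  qed
  then show ?thesis
    unfolding Stab_l_eq sl3O_iff by (simp add: block_apply[OF lin] A(2))
qed

text \<open>The octonions that associate with everything are the reals. Three pairs of units suffice to
  see this.\<close>

lemma nucleus_real:
  assumes "\<And>x y. k \<odot> (x \<odot> y) = (k \<odot> x) \<odot> y"
  shows "k = oreal (ore k)"
proof -
  obtain x y z w where k: "k = ((x, y), (z, w))" by (metis surj_pair)
  show ?thesis
    using assms[of oi oj] assms[of oi ol] assms[of oj ol]
    unfolding k by (simp add: oi_def oj_def ol_def oreal_def ore_def zero_prod_def complex_eq_iff)
qed

text \<open>Irreducibility of the spinor representation in the form that is needed: the block on spinors
  is determined by the block on vectors. A map \<open>F\<close> as below is block diagonal by the null vectors
  \<open>(1, 0, 0)\<close> and \<open>(0, 1, 0)\<close>; the vectors \<open>(0, 0, a)\<close> identify its blocks with each other and make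
  them commute with all right multiplications, up to conjugation. Hence both blocks come from left
  multiplication by an octonion in the nucleus, that is, by a real scalar, and this scalar is zero because \<open>F\<close> is skew.\<close>

lemma clifford_commutant:
  assumes "linear F" and skew: "\<And>v t. t \<bullet> clif v (F t) = 0"
  shows "F s = 0"
proof -
  define f where "f b = fst (F (b, 0))" for b
  define g where "g c = snd (F (0, c))" for c
  have split: "F (b, c) = F (b, 0) + F (0, c)" for b c
    using linear_add[OF assms(1), of "(b, 0)" "(0, c)"] by simp
  have clif_p: "clif (1, 0, 0) t = (fst t, 0)" and clif_m: "clif (0, 1, 0) t = (0, snd t)" for t
  proof -
    obtain b c where "t = (b, c)" by (metis surj_pair)
    then show "clif (1, 0, 0) t = (fst t, 0)" "clif (0, 1, 0) t = (0, snd t)"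
      by simp_all
  qed
  have skew1: "b \<bullet> fst (F (b, c)) = 0" for b c
    using skew[of "(b, c)" "(1, 0, 0)"] unfolding clif_p by simp
  have skew2: "c \<bullet> snd (F (b, c)) = 0" for b c
    using skew[of "(b, c)" "(0, 1, 0)"] unfolding clif_m by simp
  have off1: "fst (F (0, c)) = 0" for c
  proof -
    let ?x = "fst (F (0, c))"
    have "?x \<bullet> ?x = 0"
      using skew1[of ?x c, unfolded split[of ?x c] fst_add inner_add_right skew1 add_0_left] .
    then show ?thesis by simp
  qed
  have off2: "snd (F (b, 0)) = 0" for b
  proof -
    let ?x = "snd (F (b, 0))"
    have "?x \<bullet> ?x = 0"
      using skew2[of ?x b, unfolded split[of b ?x] snd_add inner_add_right skew2 add_0_right] .
    then show ?thesis by simp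
  qed
  have Ff: "F (b, c) = (f b, g c)" for b c
  proof (rule prod_eqI)
    show "fst (F (b, c)) = fst (f b, g c)"
      unfolding split[of b c] f_def by (simp add: off1)
    show "snd (F (b, c)) = snd (f b, g c)"
      unfolding split[of b c] g_def by (simp add: off2)
  qed
  have 2: "b \<bullet> ocnj (a \<odot> g c) + c \<bullet> ocnj (f b \<odot> a) = 0" for a b c
    using skew[of "(b, c)" "(0, 0, a)"] by (simp add: Ff)
  have 3: "b \<bullet> ocnj (a \<odot> y) = ocnj (b \<odot> a) \<bullet> y" for a b y
    using clif_sym[of "(b, 0)" "(0, 0, a)" "(0, y)"] by simp
  have f_mult: "f (b \<odot> a) = f b \<odot> a" for a b
  proof -
    have "c \<bullet> ocnj (f b \<odot> a) = c \<bullet> ocnj (f (b \<odot> a))" for c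
      using 2[of b a c] 2[of "b \<odot> a" "oreal 1" c] 3[of b a "g c"] 3[of "b \<odot> a" "oreal 1" "g c"]
      by (simp add: omul_one)
    then have "ocnj (f b \<odot> a) = ocnj (f (b \<odot> a))"
      using vector_eq_ldot by blast
    then show ?thesis by (metis ocnj_ocnj)
  qed
  define k where "k = f (oreal 1)"
  have f: "f x = k \<odot> x" for x
    using f_mult[of "oreal 1" x] by (simp add: omul_one k_def)
  have "k = oreal (ore k)"
    using f_mult by (intro nucleus_real) (simp add: f)
  moreover have "ore k = 0"
    using skew1[of "oreal 1" 0] by (simp add: Ff k_def oreal_def ore_def inner_complex_def)
      (simp add: inner_prod_def)
  ultimately have "k = 0" by (metis omul_oreal_left omul_one(2) scaleR_zero_left)
  then have f0: "f b = 0" for b by (simp add: f)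
  have "b \<bullet> ocnj (g c) = 0" for b c
    using 2[of b "oreal 1" c] by (simp add: f0 omul_one)
  then have "ocnj (g c) = 0" for c
    by (metis inner_eq_zero_iff)
  then have "g c = 0" for c by (metis ocnj_ocnj omul_zero(3))
  then show ?thesis by (cases s) (simp add: Ff f0 zero_prod_def)
qed

definition rot :: "mink \<Rightarrow> mink \<Rightarrow> mink \<Rightarrow> mink" where
  "rot u w v = mform u v *\<^sub>R w - mform w v *\<^sub>R u"

text \<open>The spinor representation of the infinitesimal rotation in the plane of \<open>u\<close> and \<open>w\<close>.\<close>

definition spin_rot :: "mink \<Rightarrow> mink \<Rightarrow> spin \<Rightarrow> spin" where
  "spin_rot u w s = (1 / 4) *\<^sub>R (clif (bar w) (clif u s) - clif (bar u) (clif w s))"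

lemma linear_rot: "linear (rot u w)" and linear_spin_rot: "linear (spin_rot u w)"
  by (intro linearI;
      simp add: rot_def spin_rot_def mform_simps clif_simps algebra_simps scaleR_add_left)+

text \<open>Moving \<open>v\<close> past \<open>bar u\<close> and past \<open>bar w\<close> by the Clifford relation produces the rotation of \<open>v\<close>;
  the two remaining products of three gamma matrices are transposes of each other and cancel.\<close>

lemma spin_rot_compatible: "t \<bullet> clif (rot u w v) t + 2 * (t \<bullet> clif v (spin_rot u w t)) = 0"
proof -
  have "t \<bullet> clif u (clif (bar v) (clif w t)) = t \<bullet> clif w (clif (bar v) (clif u t))"
    by (metis clif_sym inner_commute)
  moreover have c: "t \<bullet> clif v (clif (bar u) (clif w t))
      = 2 * (mform u v * (t \<bullet> clif w t)) - t \<bullet> clif u (clif (bar v) (clif w t))" for u w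
    using arg_cong[OF clif_anticomm[of v u "clif w t"], of "inner t"]
    by (simp add: inner_add_right mform_sym[of v u])
  ultimately show ?thesis
    using c[of u w] c[of w u]
    by (simp add: rot_def spin_rot_def clif_simps inner_diff_right inner_add_right right_diff_distrib)
qed

lemma rot_in_Stab_l:
  assumes "mform u lvec = 0" "mform w lvec = 0"
  shows "block (rot u w) (spin_rot u w) d \<in> Stab_l"
  using assms
  by (intro block_in_Stab_l linear_rot linear_spin_rot spin_rot_compatible)
     (simp_all add: rot_def mform_simps mform_sym)

section \<open>Coordinates orthogonal to l\<close>

lemma exhaust_9:
  fixes x :: 9
  shows "x = 1 \<or> x = 2 \<or> x = 3 \<or> x = 4 \<or> x = 5 \<or> x = 6 \<or> x = 7 \<or> x = 8 \<or> x = 9"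
proof (induct x)
  case (of_int z)
  then have "z = 0 \<or> z = 1 \<or> z = 2 \<or> z = 3 \<or> z = 4 \<or> z = 5 \<or> z = 6 \<or> z = 7 \<or> z = 8" by fastforce
  then show ?case by auto
qed

lemma UNIV_9: "UNIV = {1, 2, 3, 4, 5, 6, 7, 8, 9::9}"
  using exhaust_9 by auto

lemma forall_9: "(\<forall>i::9. P i) \<longleftrightarrow> P 1 \<and> P 2 \<and> P 3 \<and> P 4 \<and> P 5 \<and> P 6 \<and> P 7 \<and> P 8 \<and> P 9"
  by (metis exhaust_9)

lemma sum_9: "sum f (UNIV::9 set) = f 1 + f 2 + f 3 + f 4 + f 5 + f 6 + f 7 + f 8 + f 9"
  unfolding UNIV_9 by (simp add: ac_simps)

text \<open>An orthonormal basis of the orthogonal complement of \<open>l\<close>. The time-like vector comes last, to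
  agree with the position of the sign in \<^const>\<open>minkowski_form\<close>; \<^const>\<open>mform\<close> is positive on
  time-like vectors and therefore restricts to minus that form.\<close>

definition lperp :: "9 \<Rightarrow> mink" where
  "lperp i = (if i = 1 then (0, 0, oreal 1) else if i = 2 then (0, 0, oi) else if i = 3 then (0, 0, oj)
     else if i = 4 then (0, 0, ok) else if i = 5 then (0, 0, okl) else if i = 6 then (0, 0, ojl)
     else if i = 7 then (0, 0, oil) else if i = 8 then (1, - 1, 0) else (1, 1, 0))"

definition mink_sign :: "9 \<Rightarrow> real" where "mink_sign i = (if i = 9 then - 1 else 1)"

lemma mink_sign_square [simp]: "mink_sign i * mink_sign i = 1"
  by (simp add: mink_sign_def)

lemmas unit_coords = oreal_def oi_def oj_def ok_def okl_def ojl_def oil_def ol_def zero_prod_def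

lemma lperp_orth: "mform (lperp i) (lperp j) = (if i = j then - mink_sign i else 0)"
proof -
  have "\<forall>i j. mform (lperp i) (lperp j) = (if i = j then - mink_sign i else 0)"
    unfolding forall_9
    by (simp add: lperp_def mink_sign_def unit_coords inner_complex_def)
  then show ?thesis by blast
qed

lemma lperp_lvec: "mform (lperp i) lvec = 0"
proof -
  have "\<forall>i. mform (lperp i) lvec = 0"
    unfolding forall_9
    by (simp add: lperp_def lvec_def unit_coords inner_complex_def)
  then show ?thesis by blast
qed

lemma lperp_expansion:
  assumes "mform v lvec = 0"
  shows "v = (\<Sum>i\<in>UNIV. (- mink_sign i * mform (lperp i) v) *\<^sub>R lperp i)"
proof -
  obtain p m a b c d where v: "v = (p, m, ((a, b), (c, d)))" by (metis surj_pair)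
  have "Re c = 0"
    using assms by (simp add: v lvec_def unit_coords inner_complex_def)
  then show ?thesis
    unfolding sum_9
    by (simp add: v lperp_def mink_sign_def unit_coords inner_complex_def complex_eq_iff field_simps)
qed

definition coord_mat :: "(herm \<Rightarrow>\<^sub>L herm) \<Rightarrow> real^9^9" where
  "coord_mat X = (\<chi> i j. - mink_sign i * mform (lperp i) (vpart (X (assemble (lperp j) 0 0))))"

lemma linear_coord_mat: "linear coord_mat"
  by (intro linearI)
     (simp_all add: coord_mat_def vec_eq_iff blinfun.add_left blinfun.scaleR_left mform_simps
       algebra_simps)

section \<open>The dimension of so(8,1)\<close>

lemma so81_iff: "M \<in> so81 \<longleftrightarrow> (\<forall>i j. mink_sign i * M $ i $ j + M $ j $ i * mink_sign j = 0)"
proof -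
  have form: "minkowski_form $ i $ j = (if i = j then mink_sign i else 0)" for i j
    by (simp add: minkowski_form_def mink_sign_def)
  have "(transpose M ** minkowski_form + minkowski_form ** M) $ i $ j
      = mink_sign i * M $ i $ j + M $ j $ i * mink_sign j" for i j
    by (simp add: form matrix_matrix_mult_def transpose_def if_distrib if_distribR cong: if_cong)
  then show ?thesis
    unfolding so81_def by (simp add: vec_eq_iff[of "_ + _"])
qed

lemma subspace_so81: "subspace so81"
proof (rule subspaceI)
  fix A B :: "real^9^9" and r :: real
  show "0 \<in> so81" by (simp add: so81_iff)
  show "r *\<^sub>R A \<in> so81" if "A \<in> so81"
    unfolding so81_iff
  proof (intro allI)
    fix i j
    have "r * (mink_sign i * A $ i $ j + A $ j $ i * mink_sign j) = 0"
      using that unfolding so81_iff by simp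
    then show "mink_sign i * (r *\<^sub>R A) $ i $ j + (r *\<^sub>R A) $ j $ i * mink_sign j = 0"
      by (simp add: algebra_simps)
  qed
  show "A + B \<in> so81" if "A \<in> so81" "B \<in> so81"
    unfolding so81_iff
  proof (intro allI)
    fix i j
    show "mink_sign i * (A + B) $ i $ j + (A + B) $ j $ i * mink_sign j = 0"
      using that[unfolded so81_iff, rule_format, of i j] by (simp add: algebra_simps)
  qed
qed

text \<open>Spaces of bounded operators are not Euclidean spaces as types, so dimensions of subspaces are
  transported to Euclidean spaces along injective linear maps.\<close>

lemma dim_linear_image_inj:
  fixes f :: "'a::real_vector \<Rightarrow> 'b::real_vector"
  assumes f: "linear f" and S: "subspace S" and inj: "inj_on f S"
  shows "dim (f ` S) = dim S"
proof -
  obtain B where B: "B \<subseteq> S" "independent B" "S \<subseteq> span B" "card B = dim S"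
    using basis_exists by blast
  have sp: "span B = S"
    using B S span_minimal by blast
  have "independent (f ` B)"
    using linear_independent_injective_image[OF f B(2)] inj sp by simp
  moreover have "f ` S \<subseteq> span (f ` B)"
    using linear_span_image[OF f] sp by blast
  moreover have "card (f ` B) = card B"
    using inj B(1) by (intro card_image) (rule inj_on_subset)
  ultimately show ?thesis
    using dim_unique[OF image_mono[OF B(1)]] B(4) by metis
qed

lemma card_less_pairs: "2 * card {(i, j). i < (j::'a::{finite,linorder})} + CARD('a) = CARD('a) * CARD('a)"
proof -
  let ?L = "{(i, j). i < (j::'a)}" and ?G = "{(i, j). j < (i::'a)}" and ?D = "{(i, j). i = (j::'a)}"
  have "card ?G = card ?L"
    by (rule bij_betw_same_card[OF bij_betw_byWitness[where f = prod.swap and f' = prod.swap]]) auto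
  moreover have "card ?D = CARD('a)"
    by (rule bij_betw_same_card[OF bij_betw_byWitness[where f = fst and f' = "\<lambda>i. (i, i)"]]) auto
  moreover have "card (?L \<union> (?G \<union> ?D)) = card ?L + (card ?G + card ?D)"
    by (subst card_Un_disjoint; (subst card_Un_disjoint)?) auto
  moreover have "?L \<union> (?G \<union> ?D) = UNIV" by auto
  ultimately show ?thesis
    using card_cartesian_product[of "UNIV::'a set" "UNIV::'a set"] by simp
qed

text \<open>An element of so(8,1) is determined by its strictly upper triangular part, which is
  arbitrary.\<close>

lemma dim_so81: "dim so81 = 36"
proof -
  define U where "U A = (\<chi> i j. if i < j then A $ i $ j else 0)" for A :: "real^9^9"
  define d :: "(real^9^9) set" where "d = (\<lambda>(i, j). axis i (axis j 1)) ` {(i, j). i < j}"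
  have lin: "linear U"
    by (intro linearI) (simp_all add: U_def vec_eq_iff)
  have inj: "inj_on U so81"
  proof -
    have "A = 0" if A: "A \<in> so81" "U A = 0" for A
    proof -
      have up: "A $ i $ j = 0" if "i < j" for i j
        using arg_cong[OF A(2), of "\<lambda>M. M $ i $ j"] that by (simp add: U_def)
      have "A $ i $ j = 0" for i j
      proof -
        have "mink_sign i * A $ i $ j + A $ j $ i * mink_sign j = 0"
          using A(1) unfolding so81_iff by blast
        then show ?thesis
          using up[of i j] up[of j i]
          by (cases i j rule: linorder_cases) (auto simp: mink_sign_def split: if_splits)
      qed
      then show ?thesis by (simp add: vec_eq_iff)
    qed
    then show ?thesis
      using linear_inj_on_iff_eq_0[OF lin subspace_so81] by blast
  qed
  have "U ` so81 = {M. \<forall>b\<in>Basis. b \<notin> d \<longrightarrow> M \<bullet> b = 0}"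
  proof -
    have mem: "axis i (axis j (1::real)) \<in> d \<longleftrightarrow> i < j" for i j :: 9
      by (auto simp: d_def axis_eq_axis image_iff)
    have R: "{M. \<forall>b\<in>Basis. b \<notin> d \<longrightarrow> M \<bullet> b = 0} = {M. \<forall>i j. \<not> i < j \<longrightarrow> M $ i $ j = 0}"
      by (auto simp: Basis_vec_def mem inner_axis)
    have "M \<in> U ` so81" if M: "\<forall>i j. \<not> i < j \<longrightarrow> M $ i $ j = 0" for M
    proof
      define A where "A = (\<chi> i j. if i < j then M $ i $ j else - mink_sign i * mink_sign j * M $ j $ i)"
      show "A \<in> so81"
        using M unfolding so81_iff A_def by (auto simp: mink_sign_def)
      show "M = U A"
        using M by (simp add: U_def A_def vec_eq_iff)
    qed
    then show ?thesis unfolding R by (auto simp: U_def)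
  qed
  moreover have "d \<subseteq> Basis"
    by (auto simp: d_def Basis_vec_def)
  moreover have "card d = card {(i, j). i < (j::9)}"
    unfolding d_def by (rule card_image) (auto simp: inj_on_def axis_eq_axis)
  moreover have "card {(i, j). i < (j::9)} = 36"
    using card_less_pairs[where 'a = 9] by simp
  ultimately show ?thesis
    using dim_linear_image_inj[OF lin subspace_so81 inj] dim_substandard[of d] by simp
qed

section \<open>Rotation part and spinor part\<close>

lemma linear_vector_block: "linear (\<lambda>v. vpart (blinfun_apply X (assemble v 0 0)))"
  and linear_spinor_block: "linear (\<lambda>s. spart (blinfun_apply X (assemble 0 s 0)))"
  by (intro linearI; simp flip: parts_linear blinfun.add_right blinfun.scaleR_right
      add: assemble_add assemble_scaleR)+

lemma Stab_l_perp: "X \<in> Stab_l \<Longrightarrow> mform (vpart (X (assemble v s n))) lvec = 0"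
  unfolding Stab_l_eq by blast

lemma Stab_l_form_skew:
  assumes "X \<in> Stab_l"
  shows "mform (vpart (X (assemble v 0 0))) w + mform v (vpart (X (assemble w 0 0))) = 0"
proof -
  define A where "A v = vpart (X (assemble v 0 0))" for v
  have z: "mform (A v) v = 0" for v
    unfolding A_def by (rule Stab_l_blocks(2)[OF assms])
  have "A (v + w) = A v + A w"
    unfolding A_def by (rule linear_add[OF linear_vector_block])
  then have "mform (A v) w + mform (A w) v = 0"
    using z[of v] z[of w] z[of "v + w"] by (simp add: mform_simps)
  then show ?thesis
    using mform_sym[of v "A w"] unfolding A_def by simp
qed

lemma coord_mat_so81: "X \<in> Stab_l \<Longrightarrow> coord_mat X \<in> so81"
  unfolding so81_iff
proof (intro allI)
  fix i j assume "X \<in> Stab_l"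
  from Stab_l_form_skew[OF this, of "lperp j" "lperp i"]
  show "mink_sign i * coord_mat X $ i $ j + coord_mat X $ j $ i * mink_sign j = 0"
    by (simp add: coord_mat_def mform_sym[of "lperp i" "vpart _"] algebra_simps flip: mult.assoc)
qed

lemma vpart_lperp_expansion:
  assumes "X \<in> Stab_l"
  shows "vpart (X (assemble (lperp j) 0 0)) = (\<Sum>k\<in>UNIV. coord_mat X $ k $ j *\<^sub>R lperp k)"
  using lperp_expansion[OF Stab_l_perp[OF assms]] by (simp add: coord_mat_def)

text \<open>The skew block has its image orthogonal to \<open>l\<close>, so it annihilates \<open>l\<close> and is determined by its
  restriction to the complement.\<close>

lemma vpart_Stab_l_lvec:
  assumes "X \<in> Stab_l"
  shows "vpart (X (assemble lvec 0 0)) = 0"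
  using Stab_l_form_skew[OF assms, of lvec] Stab_l_perp[OF assms]
  by (intro mform_nondeg) (metis add_0_right mform_sym)

lemma coord_mat_eq_0:
  assumes X: "X \<in> Stab_l" and z: "coord_mat X = 0"
  shows "vpart (X (assemble v 0 0)) = 0"
proof -
  define A where "A v = vpart (X (assemble v 0 0))" for v
  have lin: "linear A"
    unfolding A_def by (rule linear_vector_block)
  have e: "A (lperp j) = 0" for j
    unfolding A_def vpart_lperp_expansion[OF X] by (simp add: z)
  have l: "A lvec = 0"
    unfolding A_def by (rule vpart_Stab_l_lvec[OF X])
  define w where "w = v + mform v lvec *\<^sub>R lvec"
  have "mform w lvec = 0"
    by (simp add: w_def mform_simps mform_lvec)
  from arg_cong[OF lperp_expansion[OF this], of A]
  have "A w = (\<Sum>i\<in>UNIV. A ((- mink_sign i * mform (lperp i) w) *\<^sub>R lperp i))"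
    unfolding linear_sum[OF lin] .
  also have "\<dots> = (\<Sum>i\<in>UNIV. (- mink_sign i * mform (lperp i) w) *\<^sub>R A (lperp i))"
    by (simp only: linear_scale[OF lin])
  finally have "A w = 0" by (simp add: e)
  then have "A v = 0"
    by (simp add: w_def linear_add[OF lin] linear_scale[OF lin] l)
  then show ?thesis unfolding A_def .
qed

lemma Stab_l_coord_mat_0_block:
  assumes X: "X \<in> Stab_l" and z: "coord_mat X = 0"
  shows "X = block (\<lambda>_. 0) (\<lambda>_. 0) (spart (X (assemble time_axis 0 0)))"
proof (rule blinfun_eqI)
  fix x
  obtain v s n where x: "x = assemble v s n" by (rule herm_cases)
  define F where "F s = spart (X (assemble 0 s 0))" for s
  have lin: "linear F"
    unfolding F_def by (rule linear_spinor_block)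
  have "t \<bullet> clif v (F t) = 0" for v t
    using Stab_l_blocks(4)[OF X, of t v] by (simp add: coord_mat_eq_0[OF assms] clif_simps F_def)
  then have "F s = 0" by (rule clifford_commutant[OF lin])
  then show "X x = block (\<lambda>_. 0) (\<lambda>_. 0) (spart (X (assemble time_axis 0 0))) x"
    by (simp add: x Stab_l_blocks(1)[OF X, of v s n] coord_mat_eq_0[OF assms] F_def[symmetric]
        block_apply[OF linear_zero linear_zero])
qed

definition spin_shift :: "spin \<Rightarrow> herm \<Rightarrow>\<^sub>L herm" where
  "spin_shift d = block (\<lambda>_. 0) (\<lambda>_. 0) d"

lemma spin_shift_apply:
  "spin_shift d x = assemble 0 (clif (bar (vpart x)) d) (2 * (d \<bullet> spart x))"
  unfolding spin_shift_def by (simp add: block_apply[OF linear_zero linear_zero])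

lemma spin_shift_in_Stab_l: "spin_shift d \<in> Stab_l"
  unfolding spin_shift_def
  by (intro block_in_Stab_l linear_zero) (simp_all add: mform_simps clif_simps)

text \<open>The spinor \<open>d\<close> of \<open>Stab_l_blocks\<close>, read off where \<open>clif\<close> is the identity.\<close>

definition shift_part :: "(herm \<Rightarrow>\<^sub>L herm) \<Rightarrow> spin" where
  "shift_part X = spart (X (assemble time_axis 0 0))"

lemma linear_shift_part: "linear shift_part"
  by (intro linearI) (simp_all add: shift_part_def blinfun.add_left blinfun.scaleR_left)

lemma shift_part_spin_shift [simp]: "shift_part (spin_shift d) = d"
  by (simp add: shift_part_def spin_shift_apply)

lemma coord_mat_spin_shift [simp]: "coord_mat (spin_shift d) = 0"
  by (simp add: coord_mat_def spin_shift_apply vec_eq_iff mform_simps)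

lemma Stab_l_coord_mat_0:
  "X \<in> Stab_l \<Longrightarrow> coord_mat X = 0 \<Longrightarrow> X = spin_shift (shift_part X)"
  unfolding spin_shift_def shift_part_def by (rule Stab_l_coord_mat_0_block)

text \<open>Passing to the vector block is multiplicative because the stabiliser is block triangular: the
  vector part of \<open>X y\<close> depends on the vector part of \<open>y\<close> alone.\<close>

lemma coord_mat_commutator:
  assumes X: "X \<in> Stab_l" and Y: "Y \<in> Stab_l"
  shows "coord_mat (commutator X Y) = mat_commutator (coord_mat X) (coord_mat Y)"
proof -
  have "coord_mat (X o\<^sub>L Y) = coord_mat X ** coord_mat Y" if X: "X \<in> Stab_l" and Y: "Y \<in> Stab_l" for X Y
  proof -
    have "(coord_mat (X o\<^sub>L Y)) $ i $ j = (coord_mat X ** coord_mat Y) $ i $ j" for i j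
    proof -
      define A where "A v = vpart (X (assemble v 0 0))" for v
      have lin: "linear A"
        unfolding A_def by (rule linear_vector_block)
      have "vpart (X y) = A (vpart y)" for y
        by (metis A_def Stab_l_blocks(1)[OF X] parts_assemble(1,4))
      then have "vpart (X (Y (assemble (lperp j) 0 0))) =
          (\<Sum>k\<in>UNIV. coord_mat Y $ k $ j *\<^sub>R A (lperp k))"
        by (simp add: vpart_lperp_expansion[OF Y] linear_sum[OF lin] linear_scale[OF lin])
      moreover have "linear (mform (lperp i))"
        using bilinear_mform unfolding bilinear_def by blast
      ultimately show ?thesis
        by (simp add: coord_mat_def matrix_matrix_mult_def A_def linear_sum mform_simps
            sum_distrib_left sum_negf algebra_simps)
    qed
    then show ?thesis by (simp add: vec_eq_iff)
  qed
  then show ?thesis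
    using X Y by (simp add: commutator_def mat_commutator_def linear_diff[OF linear_coord_mat])
qed

text \<open>The rotations in the coordinate planes span so(8,1), and each of them lifts to the
  stabiliser.\<close>

lemma coord_mat_surj:
  assumes M: "M \<in> so81"
  obtains X where "X \<in> Stab_l" "coord_mat X = M" "shift_part X = 0"
proof
  define \<tau> where "\<tau> k l = block (rot (lperp k) (lperp l)) (spin_rot (lperp k) (lperp l)) 0" for k l
  define X where "X = (\<Sum>k\<in>UNIV. \<Sum>l\<in>UNIV. (mink_sign l * M $ k $ l / 2) *\<^sub>R \<tau> k l)"
  have sub: "subspace Stab_l"
    using Stab_l_lie_subalgebra unfolding lie_subalgebra_def by blast
  have "\<tau> k l \<in> Stab_l" for k l
    unfolding \<tau>_def by (intro rot_in_Stab_l lperp_lvec)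
  then show "X \<in> Stab_l"
    unfolding X_def by (intro subspace_sum[OF sub] subspace_scale[OF sub]) auto
  have \<tau>: "\<tau> k l x = assemble (rot (lperp k) (lperp l) (vpart x)) (spin_rot (lperp k) (lperp l) (spart x)) 0"
    for k l x
    unfolding \<tau>_def by (simp add: block_apply[OF linear_rot linear_spin_rot] clif_simps)
  have "shift_part (\<tau> k l) = 0" for k l
    by (simp add: shift_part_def \<tau> linear_0[OF linear_spin_rot])
  then show "shift_part X = 0"
    by (simp add: X_def linear_sum[OF linear_shift_part] linear_scale[OF linear_shift_part])
  have pick: "(\<Sum>k\<in>UNIV. \<Sum>l\<in>UNIV. if k = a \<and> l = b then g k l else 0) = g a b"
    for a b and g :: "9 \<Rightarrow> 9 \<Rightarrow> real"
  proof -
    have "(\<Sum>l\<in>UNIV. if k = a \<and> l = b then g k l else 0) = (if k = a then g k b else 0)" for k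
      by (cases "k = a") simp_all
    then show ?thesis by simp
  qed
  define c where "c k l = mink_sign l * M $ k $ l / 2" for k l
  have "coord_mat (\<tau> k l) $ i $ j = - mink_sign i *
      (mform (lperp k) (lperp j) * mform (lperp i) (lperp l)
       - mform (lperp l) (lperp j) * mform (lperp i) (lperp k))" for k l i j
    by (simp add: coord_mat_def \<tau> rot_def mform_simps)
  then have "coord_mat (\<tau> k l) $ i $ j =
      (if k = j \<and> l = i then - mink_sign k else 0) + (if k = i \<and> l = j then mink_sign l else 0)"
    for k l i j
    unfolding lperp_orth
    by (cases "k = j"; cases "l = i"; cases "k = i"; cases "l = j") simp_all
  then have entry: "c k l * coord_mat (\<tau> k l) $ i $ j =
      (if k = j \<and> l = i then - mink_sign k * c k l else 0)
      + (if k = i \<and> l = j then mink_sign l * c k l else 0)" for k l i j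
    by (simp only: distrib_left if_distrib[of "(*) _"] mult_zero_left mult_zero_right mult.commute)
  have "coord_mat X $ i $ j = M $ i $ j" for i j
  proof -
    have "coord_mat X $ i $ j = (\<Sum>k\<in>UNIV. \<Sum>l\<in>UNIV. c k l * coord_mat (\<tau> k l) $ i $ j)"
      unfolding X_def c_def
      by (simp add: linear_sum[OF linear_coord_mat] linear_scale[OF linear_coord_mat])
    also have "\<dots> = - mink_sign j * c j i + mink_sign j * c i j"
      unfolding entry sum.distrib pick ..
    also have "\<dots> = M $ i $ j"
      using M[unfolded so81_iff, rule_format, of i j]
      by (cases "i = 9"; cases "j = 9"; simp add: c_def mink_sign_def field_simps)
    finally show ?thesis .
  qed
  then show "coord_mat X = M" by (simp add: vec_eq_iff)
qed

lemma bar_0 [simp]: "bar 0 = 0"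
  by (simp add: zero_prod_def)

text \<open>The composite of two such maps sends a vector to a number only, by a form which is symmetric
  in the two spinors since \<open>clif v\<close> is a symmetric operator.\<close>

lemma spin_shift_commute: "commutator (spin_shift d) (spin_shift d') = 0"
proof (rule blinfun_eqI)
  fix x
  have "d \<bullet> clif (bar (vpart x)) d' = d' \<bullet> clif (bar (vpart x)) d"
    by (rule clif_swap)
  then show "commutator (spin_shift d) (spin_shift d') x = blinfun_apply 0 x"
    by (simp add: commutator_def blinfun.diff_left spin_shift_apply bar_linear clif_simps)
qed

section \<open>The structure of the stabiliser\<close>

theorem mainTheorem3:
  shows "lie_subalgebra commutator Stab_l sl3O
    \<and> dim Stab_l = 52
    \<and> \<not> lie_simple commutator Stab_l
    \<and> \<not> lie_semisimple commutator Stab_l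
    \<and> (\<exists>h b.
          lie_subalgebra commutator h Stab_l
        \<and> lie_isomorphic commutator h mat_commutator so81
        \<and> lie_ideal commutator b Stab_l
        \<and> lie_abelian commutator b
        \<and> dim b = 16
        \<and> h \<inter> b = {0}
        \<and> Stab_l = {x + y |x y. x \<in> h \<and> y \<in> b})"
proof -
  have sub: "subspace Stab_l"
    and closed: "\<And>X Y. X \<in> Stab_l \<Longrightarrow> Y \<in> Stab_l \<Longrightarrow> commutator X Y \<in> Stab_l"
    using Stab_l_lie_subalgebra unfolding lie_subalgebra_def by blast+
  \<comment> \<open>\<open>b\<close> is the kernel of the rotation part, hence an ideal; \<open>h\<close> is a complement that preserves
    the decomposition into vectors, spinors and numbers.\<close>
  define h where "h = {X \<in> Stab_l. shift_part X = 0}"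
  define b where "b = {X \<in> Stab_l. coord_mat X = 0}"

  have b_sub: "subspace b"
    using sub linear_0[OF linear_coord_mat] linear_add[OF linear_coord_mat]
      linear_scale[OF linear_coord_mat]
    unfolding b_def subspace_def by simp
  have h_sub: "subspace h"
    using sub linear_0[OF linear_shift_part] linear_add[OF linear_shift_part]
      linear_scale[OF linear_shift_part]
    unfolding h_def subspace_def by simp
  have b_range: "b = range spin_shift"
    unfolding b_def using Stab_l_coord_mat_0 spin_shift_in_Stab_l by auto
  have zero: "X = 0" if "X \<in> Stab_l" "coord_mat X = 0" "shift_part X = 0" for X
    using Stab_l_coord_mat_0[OF that(1,2)] unfolding that(3)
    by (auto intro!: blinfun_eqI simp: spin_shift_apply clif_simps)
       (metis assemble_scaleR mult_zero_left scaleR_zero_left)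

  have ideal: "lie_ideal commutator b Stab_l"
    unfolding lie_ideal_def
  proof (intro conjI ballI b_sub)
    show "b \<subseteq> Stab_l" unfolding b_def by blast
    show "commutator X Y \<in> b" if "X \<in> Stab_l" "Y \<in> b" for X Y
      using that closed unfolding b_def
      by (simp add: coord_mat_commutator mat_commutator_def)
  qed
  have abelian: "lie_abelian commutator b"
    unfolding lie_abelian_def b_range using spin_shift_commute by auto
  have "inj_on shift_part b"
    unfolding linear_inj_on_iff_eq_0[OF linear_shift_part b_sub]
    using zero unfolding b_def by blast
  moreover have "shift_part ` b = UNIV"
    unfolding b_range image_image by simp
  ultimately have dim_b: "dim b = 16"
    using dim_linear_image_inj[OF linear_shift_part b_sub] by simp

  have subalg: "lie_subalgebra commutator h Stab_l"
    unfolding lie_subalgebra_def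
  proof (intro conjI ballI h_sub)
    show "h \<subseteq> Stab_l" unfolding h_def by blast
    show "commutator X Y \<in> h" if "X \<in> h" "Y \<in> h" for X Y
    proof -
      have "spart (X (Y (assemble time_axis 0 0))) = 0" if "X \<in> h" "Y \<in> h" for X Y
      proof -
        have "Y (assemble time_axis 0 0) = assemble (vpart (Y (assemble time_axis 0 0))) 0 0"
          using that Stab_l_blocks(1)[of Y time_axis 0 0]
          by (simp add: h_def shift_part_def) (metis parts_assemble(2,3) inner_zero_left mult_zero_right)
        then show ?thesis
          using that Stab_l_blocks(1)[of X _ 0 0] unfolding h_def shift_part_def
          by (smt (verit) blinfun.zero_right clif_simps(8) mem_Collect_eq parts_assemble add_0_right)
      qed
      then show ?thesis
        using that closed unfolding h_def
        by (simp add: shift_part_def commutator_def blinfun.diff_left linear_diff[OF linear_spart])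
    qed
  qed
  have "inj_on coord_mat h"
    unfolding linear_inj_on_iff_eq_0[OF linear_coord_mat h_sub]
    using zero unfolding h_def by blast
  moreover have "coord_mat ` h = so81"
    unfolding h_def using coord_mat_so81 coord_mat_surj by (auto simp: image_iff) metis
  ultimately have iso: "lie_isomorphic commutator h mat_commutator so81"
    unfolding lie_isomorphic_def bij_betw_def
    using linear_coord_mat coord_mat_commutator unfolding h_def by blast

  have inter: "h \<inter> b = {0}"
    using zero subspace_0[OF h_sub] subspace_0[OF b_sub] unfolding h_def b_def by blast
  have sum: "Stab_l = {x + y |x y. x \<in> h \<and> y \<in> b}"
  proof (intro equalityI subsetI)
    fix X assume X: "X \<in> Stab_l"
    let ?Y = "spin_shift (shift_part X)"
    have "X - ?Y \<in> h"
      using X spin_shift_in_Stab_l subspace_diff[OF sub]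
      by (simp add: h_def linear_diff[OF linear_shift_part])
    moreover have "?Y \<in> b" unfolding b_range by blast
    moreover have "X = (X - ?Y) + ?Y" by simp
    ultimately show "X \<in> {x + y |x y. x \<in> h \<and> y \<in> b}" by blast
  next
    fix X assume "X \<in> {x + y |x y. x \<in> h \<and> y \<in> b}"
    then show "X \<in> Stab_l"
      using subspace_add[OF sub] unfolding h_def b_def by blast
  qed

  have dim: "dim Stab_l = 52"
  proof -
    define \<Theta> where "\<Theta> X = (coord_mat X, shift_part X)" for X
    have lin: "linear \<Theta>"
      by (intro linearI) (simp_all add: \<Theta>_def linear_add[OF linear_coord_mat]
          linear_add[OF linear_shift_part] linear_scale[OF linear_coord_mat]
          linear_scale[OF linear_shift_part])
    have "inj_on \<Theta> Stab_l"
      unfolding linear_inj_on_iff_eq_0[OF lin sub]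
      using zero by (simp add: \<Theta>_def zero_prod_def)
    moreover have "\<Theta> ` Stab_l = so81 \<times> UNIV"
    proof (intro equalityI subsetI)
      fix y assume "y \<in> so81 \<times> (UNIV :: spin set)"
      then obtain M d where y: "y = (M, d)" and M: "M \<in> so81" by blast
      obtain X where X: "X \<in> Stab_l" "coord_mat X = M" "shift_part X = 0"
        using coord_mat_surj[OF M] .
      have "\<Theta> (X + spin_shift d) = y"
        unfolding \<Theta>_def y
        by (simp add: linear_add[OF linear_coord_mat] linear_add[OF linear_shift_part] X)
      then show "y \<in> \<Theta> ` Stab_l"
        using subspace_add[OF sub X(1) spin_shift_in_Stab_l] by blast
    qed (auto simp: \<Theta>_def coord_mat_so81)
    ultimately have "dim Stab_l = dim (so81 \<times> (UNIV :: spin set))"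
      using dim_linear_image_inj[OF lin sub] by simp
    also have "\<dots> = 52"
      by (subst dim_Times) (simp_all add: subspace_so81 dim_so81)
    finally show ?thesis .
  qed

  have b_nz: "b \<noteq> {0}"
    using dim_b dim_le_card[of "{0 :: herm \<Rightarrow>\<^sub>L herm}" "{}"] by auto
  have "b \<noteq> Stab_l" using dim dim_b by auto
  then have not_simple: "\<not> lie_simple commutator Stab_l"
    unfolding lie_simple_def using ideal b_nz by blast
  have "{commutator x y |x y. x \<in> b \<and> y \<in> b} = {0}"
  proof (intro equalityI subsetI)
    fix z :: "herm \<Rightarrow>\<^sub>L herm" assume "z \<in> {0}"
    then have "z = commutator 0 0" by (simp add: commutator_def)
    then show "z \<in> {commutator x y |x y. x \<in> b \<and> y \<in> b}"
      using subspace_0[OF b_sub] by blast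
  next
    fix z assume "z \<in> {commutator x y |x y. x \<in> b \<and> y \<in> b}"
    then show "z \<in> {0}"
      using abelian unfolding lie_abelian_def by blast
  qed
  then have "derived_series commutator b (Suc 0) = {0}"
    by simp
  then have "lie_solvable commutator b"
    unfolding lie_solvable_def by blast
  then have not_semisimple: "\<not> lie_semisimple commutator Stab_l"
    unfolding lie_semisimple_def using ideal b_nz by blast

  show ?thesis
    using Stab_l_lie_subalgebra dim not_simple not_semisimple
      subalg iso ideal abelian dim_b inter sum by blast
qed

end
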